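(* Let $p>1$ and let $s,q,V:\mathbb{R}^3\to(0,\infty)$ be radially symmetric $C^2$-functions, and put $T=2\pi\sqrt{s(0)/q(0)}$. Assume (H2), (H3), (H4) below and either (H1) or (H1)': (H1) $T\sqrt{q(x)/s(x)}<2\pi$ for all $x\neq0$; (H1)' $T\sqrt{q(x)/s(x)}>2\pi$ for all $x\neq 0$; (H2) $\bigl|2\pi-T\sqrt{q(x)/s(x)}\bigr|^{\frac{1}{p-1}}\to 0$ in the $C^2$-sense as $x\to 0$; (H3) $\sup_{x\in\mathbb{R}^3}\bigl|2\pi-T\sqrt{q(x)/s(x)}\bigr|\,e^{\delta(p-1)|x|}<\infty$ for some $\delta>0$; (H4) $\sup_{x\in\mathbb{R}^3} q(x)/V(x)<\infty$. Then there exists a continuum of $T$-periodic $\mathbb{C}^3$-valued monochromatic breather solutions $U(x,t)=e^{\frac{2\pi}{T}it}\mathbf{U}(x)$ of $$s(x)\partial_t^2U+\nabla\times\nabla\times U+q(x)U\pm V(x)|U|^{p-1}U=0\quad\text{on }\mathbb{R}^3\times\mathbb{R},$$ with sign $+$ in case (H1) and sign $-$ in case (H1)', satisfying $\sup_{x\in\mathbb{R}^3}|\mathbf{U}(x)|e^{\delta|x|}<\infty$.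
   Context: A function $f:\mathbb{R}^3\to\mathbb{R}$ is radially symmetric if $f(x)$ depends only on $|x|$. For $f:\mathbb{R}^3\to\mathbb{R}$ one says $f(x)\to 0$ in the $C^2$-sense as $x\to 0$ if $f(x)\to0$, $\nabla f(x)\to 0$ and $D^2f(x)\to 0$ as $x\to 0$. Solutions are classical; $|U|$ denotes the Euclidean norm in $\mathbb{C}^3$. *)

theory Defs
  imports "HOL-Analysis.Analysis"
begin

definition has_pd :: "'n::finite \<Rightarrow> (real^'n \<Rightarrow> 'b::real_normed_vector) \<Rightarrow> real^'n \<Rightarrow> bool" where
  "has_pd j f x \<longleftrightarrow> (\<lambda>h. f (x + h *\<^sub>R axis j 1)) differentiable (at 0)"

definition pd :: "'n::finite \<Rightarrow> (real^'n \<Rightarrow> 'b::real_normed_vector) \<Rightarrow> real^'n \<Rightarrow> 'b" where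
  "pd j f x = vector_derivative (\<lambda>h. f (x + h *\<^sub>R axis j 1)) (at 0)"

definition C2 :: "(real^'n::finite \<Rightarrow> 'b::real_normed_vector) \<Rightarrow> bool" where
  "C2 f \<longleftrightarrow> continuous_on UNIV f
     \<and> (\<forall>i x. has_pd i f x) \<and> (\<forall>i. continuous_on UNIV (pd i f))
     \<and> (\<forall>i j x. has_pd j (pd i f) x) \<and> (\<forall>i j. continuous_on UNIV (pd j (pd i f)))"

definition radial :: "(real^'n::finite \<Rightarrow> 'b) \<Rightarrow> bool" where
  "radial f \<longleftrightarrow> (\<forall>x y. norm x = norm y \<longrightarrow> f x = f y)"

definition C2_tends_zero :: "(real^'n::finite \<Rightarrow> real) \<Rightarrow> bool" where
  "C2_tends_zero f \<longleftrightarrow> (f \<longlongrightarrow> 0) (at 0)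
     \<and> (\<forall>i. (\<forall>\<^sub>F x in at 0. has_pd i f x) \<and> (pd i f \<longlongrightarrow> 0) (at 0))
     \<and> (\<forall>i j. (\<forall>\<^sub>F x in at 0. has_pd j (pd i f) x) \<and> (pd j (pd i f) \<longlongrightarrow> 0) (at 0))"

definition curl :: "(real^3 \<Rightarrow> complex^3) \<Rightarrow> real^3 \<Rightarrow> complex^3" where
  "curl F x = (\<chi> k.
     if k = 1 then pd 2 (\<lambda>y. F y $ 3) x - pd 3 (\<lambda>y. F y $ 2) x
     else if k = 2 then pd 3 (\<lambda>y. F y $ 1) x - pd 1 (\<lambda>y. F y $ 3) x
     else pd 1 (\<lambda>y. F y $ 2) x - pd 2 (\<lambda>y. F y $ 1) x)"

definition cscale :: "complex \<Rightarrow> complex^3 \<Rightarrow> complex^3" where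
  "cscale c v = (\<chi> k. c * v $ k)"

definition dtt :: "(real^3 \<Rightarrow> real \<Rightarrow> complex^3) \<Rightarrow> real^3 \<Rightarrow> real \<Rightarrow> complex^3" where
  "dtt U x t = vector_derivative (\<lambda>\<tau>. vector_derivative (\<lambda>\<sigma>. U x \<sigma>) (at \<tau>)) (at t)"

definition breather :: "real \<Rightarrow> (real^3 \<Rightarrow> complex^3) \<Rightarrow> real^3 \<Rightarrow> real \<Rightarrow> complex^3" where
  "breather T Uf x t = cscale (exp (\<i> * complex_of_real (2 * pi / T * t))) (Uf x)"

definition solves_eq :: "real \<Rightarrow> real \<Rightarrow> (real^3 \<Rightarrow> real) \<Rightarrow> (real^3 \<Rightarrow> real) \<Rightarrow> (real^3 \<Rightarrow> real)
     \<Rightarrow> (real^3 \<Rightarrow> real \<Rightarrow> complex^3) \<Rightarrow> bool" where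
  "solves_eq \<sigma> p s q V U \<longleftrightarrow>
     (\<forall>x t. s x *\<^sub>R dtt U x t + curl (curl (\<lambda>y. U y t)) x + q x *\<^sub>R U x t
            + (\<sigma> * V x * norm (U x t) powr (p - 1)) *\<^sub>R U x t = 0)"

definition good_breather :: "real \<Rightarrow> real \<Rightarrow> real \<Rightarrow> (real^3 \<Rightarrow> real) \<Rightarrow> (real^3 \<Rightarrow> real)
     \<Rightarrow> (real^3 \<Rightarrow> real) \<Rightarrow> real \<Rightarrow> (real^3 \<Rightarrow> complex^3) \<Rightarrow> bool" where
  "good_breather \<sigma> p T s q V \<delta> Uf \<longleftrightarrow>
     C2 Uf \<and> solves_eq \<sigma> p s q V (breather T Uf)
     \<and> (\<forall>x t. breather T Uf x (t + T) = breather T Uf x t)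
     \<and> (\<exists>C. \<forall>x. norm (Uf x) * exp (\<delta> * norm x) \<le> C)"

text \<open>A continuum of such breathers: a nondegenerate arc, i.e. an injective family
  indexed by [0,1] that is continuous with respect to uniform convergence.\<close>
definition breather_continuum :: "real \<Rightarrow> real \<Rightarrow> real \<Rightarrow> (real^3 \<Rightarrow> real) \<Rightarrow> (real^3 \<Rightarrow> real)
     \<Rightarrow> (real^3 \<Rightarrow> real) \<Rightarrow> real \<Rightarrow> bool" where
  "breather_continuum \<sigma> p T s q V \<delta> \<longleftrightarrow>
     (\<exists>F :: real \<Rightarrow> real^3 \<Rightarrow> complex^3.
        inj_on F {0..1}
        \<and> (\<forall>a\<in>{0..1}. good_breather \<sigma> p T s q V \<delta> (F a))
        \<and> (\<forall>a0\<in>{0..1}. \<forall>\<epsilon>>0. \<exists>d>0. \<forall>a\<in>{0..1}. \<bar>a - a0\<bar> < d \<longrightarrow>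
              (\<forall>x. norm (F a x - F a0 x) \<le> \<epsilon>)))"

end

theory Submission
  imports Defs
begin

text \<open>Radial fields \<open>\<rho>(|x|) x/|x|\<close> have a symmetric Jacobian, hence are curl free. So the ansatz
  \<open>U(x,t) = exp(i(\<omega>t + a)) \<rho>(|x|) x/|x|\<close> with \<open>\<omega> = 2\<pi>/T\<close> turns the equation into the algebraic
  relation \<open>\<plusminus>V \<rho> powr (p - 1) = s\<omega>\<^sup>2 - q\<close>. Its solution is the product of
  \<open>|2\<pi> - T\<surd>(q/s)| powr (1/(p - 1))\<close> and a positive \<open>C\<^sup>2\<close> function. By (H2) the first
  factor vanishes to second order at the origin, which is what \<open>C\<^sup>2\<close> regularity of the field needs
  there, and (H3), (H4) give the decay.
  The constant phase \<open>a\<close> parametrises the continuum.\<close>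

section \<open>Radial vector fields and their first two derivatives\<close>

lemma filterlim_norm_at_right_0:
  "filterlim norm (at_right 0) (at (0::'a::real_normed_vector))"
  unfolding filterlim_at by (auto simp: eventually_at_filter tendsto_norm_zero)

text \<open>Chain rule with gradient \<open>x / norm x\<close> of the norm. The division is put into
  the coefficient, so that differentiating \<open>A\<close> and \<open>B\<close> along the norm
  produces \<open>B\<close> and \<open>C\<close> as coefficients of the plain inner product.\<close>

lemma has_derivative_radial:
  fixes x :: "'a::real_inner"
  assumes "(g has_real_derivative d) (at (norm x))" and "x \<noteq> 0"
  shows "((\<lambda>y. g (norm y)) has_derivative (\<lambda>v. d / norm x * (x \<bullet> v))) (at x)"
proof -
  have "(norm has_derivative (\<lambda>v. x \<bullet> v / norm x)) (at x)"
    using GDERIV_norm[OF assms(2)]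
    by (simp add: gderiv_def sgn_div_norm inner_commute divide_inverse mult.commute)
  from has_derivative_compose[OF this assms(1)[unfolded has_field_derivative_def]]
  show ?thesis by (simp add: field_simps)
qed

lemma has_derivative_at_0_zeroI:
  assumes "f 0 = 0" and "((\<lambda>h. norm (f h) / norm h) \<longlongrightarrow> 0) (at 0)"
  shows "(f has_derivative (\<lambda>_. 0)) (at 0)"
  using assms by (simp add: has_derivative_at)

text \<open>The one-sided limits force \<open>\<rho>\<close> to be o(r^2) and \<open>\<rho>'\<close>
  to be o(r) at 0. This is the flatness that makes \<rho>(|x|) x/|x| twice continuously
  differentiable at the origin, with all derivatives up to order two equal to 0 there.\<close>

locale radial_profile =
  fixes \<rho> \<rho>' \<rho>'' :: "real \<Rightarrow> real"
  assumes \<rho>: "\<And>r. r > 0 \<Longrightarrow> (\<rho> has_real_derivative \<rho>' r) (at r)"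
    and \<rho>': "\<And>r. r > 0 \<Longrightarrow> (\<rho>' has_real_derivative \<rho>'' r) (at r)"
    and cont_\<rho>'': "continuous_on {0<..} \<rho>''"
    and lim_\<rho>: "(\<rho> \<longlongrightarrow> 0) (at_right 0)"
    and lim_\<rho>': "(\<rho>' \<longlongrightarrow> 0) (at_right 0)"
    and lim_\<rho>'': "(\<rho>'' \<longlongrightarrow> 0) (at_right 0)"
begin

text \<open>\<open>B = A' / r\<close> and \<open>C = B' / r\<close>. All three vanish at \<open>r = 0\<close> because of \<open>x / 0 = 0\<close>, so the
  formulas for \<open>field'\<close> and \<open>field''\<close> below give the correct value \<open>0\<close> at the origin.\<close>

definition "A r = \<rho> r / r"
definition "B r = (\<rho>' r * r - \<rho> r) / r ^ 3"
definition "C r = (\<rho>'' r * r\<^sup>2 - 3 * \<rho>' r * r + 3 * \<rho> r) / r ^ 5"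

text \<open>L'Hopital's rule compares the quotient with \<open>\<rho>''\<close>, and once more gives
  \<open>\<rho> r / r\<^sup>2\<close>. Together with the limit of \<open>\<rho>''\<close> these two
  limits carry the whole analysis at the origin: those of \<open>A\<close>, \<open>B\<close> and
  \<open>C\<close> are linear combinations of them.\<close>

lemma lim_\<rho>'_over: "((\<lambda>r. \<rho>' r / r) \<longlongrightarrow> 0) (at_right 0)"
proof (rule lhopital_right_0[where f' = \<rho>'' and g' = "\<lambda>_. 1"])
  show "eventually (\<lambda>x. (\<rho>' has_real_derivative \<rho>'' x) (at x)) (at_right 0)"
    using \<rho>' by (auto simp: eventually_at_filter)
qed (use lim_\<rho>' lim_\<rho>'' in \<open>auto simp: eventually_at_filter\<close>)

lemma lim_\<rho>_over: "((\<lambda>r. \<rho> r / r\<^sup>2) \<longlongrightarrow> 0) (at_right 0)"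
proof (rule lhopital_right_0[where f' = \<rho>' and g' = "\<lambda>r. 2 * r"])
  show "eventually (\<lambda>x. (\<rho> has_real_derivative \<rho>' x) (at x)) (at_right 0)"
    using \<rho> by (auto simp: eventually_at_filter)
  show "((\<lambda>r. \<rho>' r / (2 * r)) \<longlongrightarrow> 0) (at_right 0)"
    using tendsto_mult[OF tendsto_const[of "1/2"] lim_\<rho>'_over] by simp
  show "((\<lambda>r::real. r\<^sup>2) \<longlongrightarrow> 0) (at_right 0)"
    by (auto intro!: tendsto_eq_intros)
  show "\<forall>\<^sub>F r::real in at_right 0. ((\<lambda>r. r\<^sup>2) has_real_derivative 2 * r) (at r)"
    by (intro always_eventually allI) (auto intro!: derivative_eq_intros)
qed (use lim_\<rho> in \<open>auto simp: eventually_at_filter\<close>)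

lemma lim_A: "(A \<longlongrightarrow> 0) (at_right 0)"
proof (rule Lim_transform_eventually)
  show "((\<lambda>r. \<rho> r / r\<^sup>2 * r) \<longlongrightarrow> 0) (at_right 0)"
    using tendsto_mult[OF lim_\<rho>_over tendsto_ident_at] by simp
qed (auto simp: eventually_at_filter A_def power2_eq_square)

lemma lim_A_over: "((\<lambda>r. A r / r) \<longlongrightarrow> 0) (at_right 0)"
  using lim_\<rho>_over by (simp add: A_def power2_eq_square)

lemma lim_B: "((\<lambda>r. B r * r) \<longlongrightarrow> 0) (at_right 0)"
proof (rule Lim_transform_eventually)
  show "((\<lambda>r. \<rho>' r / r - \<rho> r / r\<^sup>2) \<longlongrightarrow> 0) (at_right 0)"
    using tendsto_diff[OF lim_\<rho>'_over lim_\<rho>_over] by simp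
qed (auto simp: eventually_at_filter B_def field_simps power2_eq_square power3_eq_cube)

text \<open>The weights \<open>r\<close> for \<open>B\<close> and \<open>r ^ 3\<close> for
  \<open>C\<close> are the powers of |x| that accompany these coefficients in the size of
  \<open>field''\<close>.\<close>

lemma lim_C: "((\<lambda>r. C r * r ^ 3) \<longlongrightarrow> 0) (at_right 0)"
proof (rule Lim_transform_eventually)
  show "((\<lambda>r. \<rho>'' r - 3 * (\<rho>' r / r) + 3 * (\<rho> r / r\<^sup>2)) \<longlongrightarrow> 0) (at_right 0)"
    using tendsto_add[OF tendsto_diff[OF lim_\<rho>'' tendsto_mult_right_zero[OF lim_\<rho>'_over, of 3]]
        tendsto_mult_right_zero[OF lim_\<rho>_over, of 3]] by simp
qed (auto simp: eventually_at_filter C_def field_simps eval_nat_numeral)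

lemma deriv_A: "r > 0 \<Longrightarrow> (A has_real_derivative B r * r) (at r)"
  unfolding A_def[abs_def] B_def
  by (auto intro!: derivative_eq_intros \<rho> simp: field_simps eval_nat_numeral)

lemma deriv_B: "r > 0 \<Longrightarrow> (B has_real_derivative C r * r) (at r)"
  unfolding B_def[abs_def] C_def
  by (auto intro!: derivative_eq_intros \<rho> \<rho>' simp: field_simps eval_nat_numeral)

definition field :: "'a::real_inner \<Rightarrow> 'a" where
  "field x = A (norm x) *\<^sub>R x"

text \<open>The Jacobian of \<open>field\<close> at \<open>x\<close>, applied to \<open>v\<close>.
  As a matrix it is B x x^T + A I, hence symmetric.\<close>

definition field' :: "'a::real_inner \<Rightarrow> 'a \<Rightarrow> 'a" where
  "field' x v = (B (norm x) * (x \<bullet> v)) *\<^sub>R x + A (norm x) *\<^sub>R v"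

text \<open>The second derivative: \<open>e\<close> is the direction of the first differentiation,
  \<open>v\<close> that of the second.\<close>

definition field'' :: "'a::real_inner \<Rightarrow> 'a \<Rightarrow> 'a \<Rightarrow> 'a" where
  "field'' x e v = (C (norm x) * (x \<bullet> v) * (x \<bullet> e)) *\<^sub>R x + (B (norm x) * (v \<bullet> e)) *\<^sub>R x
     + (B (norm x) * (x \<bullet> e)) *\<^sub>R v + (B (norm x) * (x \<bullet> v)) *\<^sub>R e"

lemma norm_field: "\<rho> 0 = 0 \<Longrightarrow> norm (field x) = \<bar>\<rho> (norm x)\<bar>"
  by (simp add: field_def A_def)

lemma has_derivative_field: "(field has_derivative field' x) (at x)"
proof (cases "x = 0")
  case True
  \<comment> \<open>At the origin the difference quotient of \<open>field\<close> has norm exactly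
    |A(|h|)|.\<close>
  have "((\<lambda>h::'a. norm (A (norm h))) \<longlongrightarrow> 0) (at 0)"
    by (intro tendsto_norm_zero filterlim_compose[OF lim_A filterlim_norm_at_right_0])
  then have "((\<lambda>h::'a. norm (field h) / norm h) \<longlongrightarrow> 0) (at 0)"
    by (rule Lim_transform_eventually) (auto simp: eventually_at_filter field_def)
  then have "(field has_derivative (\<lambda>_. 0)) (at (0::'a))"
    by (rule has_derivative_at_0_zeroI[rotated]) (simp add: field_def)
  then show ?thesis by (simp add: True field'_def[abs_def] A_def B_def)
next
  case False
  then have *: "((\<lambda>y. A (norm y)) has_derivative (\<lambda>v. B (norm x) * (x \<bullet> v))) (at x)"
    using has_derivative_radial[OF deriv_A, of x] by simp
  show ?thesis
    unfolding field_def[abs_def] field'_def[abs_def]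
    by (rule has_derivative_eq_rhs, rule has_derivative_scaleR[OF * has_derivative_ident])
      (auto simp: algebra_simps)
qed

lemma has_derivative_field': "((\<lambda>y. field' y e) has_derivative field'' x e) (at x)"
proof (cases "x = 0")
  case True
  \<comment> \<open>By Cauchy-Schwarz the \<open>B\<close> term of \<open>field' h e\<close> is at
    most |B| |h|^2 |e|; dividing by |h| leaves the combinations whose limits are known.\<close>
  let ?b = "\<lambda>h::'a. norm (B (norm h) * norm h) * norm e + norm (A (norm h) / norm h) * norm e"
  have "(?b \<longlongrightarrow> 0) (at 0)"
    by (intro tendsto_add_zero tendsto_mult_left_zero tendsto_norm_zero
       filterlim_compose[OF lim_B filterlim_norm_at_right_0]
       filterlim_compose[OF lim_A_over filterlim_norm_at_right_0])
  then have "((\<lambda>h::'a. norm (field' h e) / norm h) \<longlongrightarrow> 0) (at 0)"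
  proof (rule Lim_null_comparison[rotated])
    have "norm (field' h e) / norm h \<le> ?b h"
      if "h \<noteq> 0" for h :: 'a
    proof -
      have "norm (field' h e) \<le> \<bar>B (norm h)\<bar> * \<bar>h \<bullet> e\<bar> * norm h + \<bar>A (norm h)\<bar> * norm e"
        unfolding field'_def by (rule norm_triangle_le) (simp add: abs_mult)
      also have "\<dots> \<le> \<bar>B (norm h)\<bar> * (norm h * norm e) * norm h + \<bar>A (norm h)\<bar> * norm e"
        by (intro add_right_mono mult_right_mono mult_left_mono Cauchy_Schwarz_ineq2) auto
      finally show ?thesis using that by (simp add: field_simps abs_mult)
    qed
    then show "\<forall>\<^sub>F h::'a in at 0. norm (norm (field' h e) / norm h) \<le> ?b h"
      by (auto simp: eventually_at_filter)
  qed
  then have "((\<lambda>y. field' y e) has_derivative (\<lambda>_. 0)) (at (0::'a))"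
    by (rule has_derivative_at_0_zeroI[rotated]) (simp add: field'_def A_def)
  then show ?thesis by (simp add: True field''_def[abs_def] C_def B_def)
next
  case False
  then have A: "((\<lambda>y. A (norm y)) has_derivative (\<lambda>v. B (norm x) * (x \<bullet> v))) (at x)"
    and B: "((\<lambda>y. B (norm y)) has_derivative (\<lambda>v. C (norm x) * (x \<bullet> v))) (at x)"
    using has_derivative_radial[OF deriv_A, of x] has_derivative_radial[OF deriv_B, of x] by simp_all
  show ?thesis
    unfolding field'_def[abs_def] field''_def[abs_def]
    by (rule has_derivative_eq_rhs,
       rule has_derivative_add[OF
         has_derivative_scaleR[OF has_derivative_mult[OF B has_derivative_inner_left[OF has_derivative_ident]] has_derivative_ident]
         has_derivative_scaleR[OF A has_derivative_const]])
      (auto simp: algebra_simps)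
qed

lemma isCont_field'': "isCont (\<lambda>x. field'' x e v) x"
proof (cases "x = 0")
  case True
  \<comment> \<open>Cauchy-Schwarz again: the \<open>C\<close> term contains three factors |h|, and
    each of the three \<open>B\<close> terms is at most |B| |h| |v| |e|, whence the 3.\<close>
  let ?b = "\<lambda>h::'a. norm (C (norm h) * norm h ^ 3) * (norm v * norm e)
    + norm (B (norm h) * norm h) * (3 * (norm v * norm e))"
  have "(?b \<longlongrightarrow> 0) (at 0)"
    by (intro tendsto_add_zero tendsto_mult_left_zero tendsto_norm_zero
       filterlim_compose[OF lim_B filterlim_norm_at_right_0]
       filterlim_compose[OF lim_C filterlim_norm_at_right_0])
  then have "((\<lambda>x. field'' x e v) \<longlongrightarrow> 0) (at (0::'a))"
  proof (rule Lim_null_comparison[rotated])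
    have "norm (field'' h e v) \<le> ?b h" for h :: 'a
    proof -
      have "norm (field'' h e v) \<le> \<bar>C (norm h)\<bar> * \<bar>h \<bullet> v\<bar> * \<bar>h \<bullet> e\<bar> * norm h
          + \<bar>B (norm h)\<bar> * \<bar>v \<bullet> e\<bar> * norm h
          + \<bar>B (norm h)\<bar> * \<bar>h \<bullet> e\<bar> * norm v + \<bar>B (norm h)\<bar> * \<bar>h \<bullet> v\<bar> * norm e"
        unfolding field''_def by (intro norm_triangle_mono) (simp_all add: abs_mult)
      also have "\<dots> \<le> \<bar>C (norm h)\<bar> * (norm h * norm v) * (norm h * norm e) * norm h
          + \<bar>B (norm h)\<bar> * (norm v * norm e) * norm h
          + \<bar>B (norm h)\<bar> * (norm h * norm e) * norm v + \<bar>B (norm h)\<bar> * (norm h * norm v) * norm e"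
        by (intro add_mono mult_mono order_refl Cauchy_Schwarz_ineq2) auto
      finally show ?thesis by (simp add: abs_mult algebra_simps power3_eq_cube)
    qed
    then show "\<forall>\<^sub>F h in at 0. norm (field'' h e v) \<le> ?b h" by simp
  qed
  then show ?thesis by (simp add: True isCont_def field''_def C_def B_def)
next
  case False
  have r: "continuous_on {0<..} \<rho>" "continuous_on {0<..} \<rho>'"
    using \<rho> \<rho>' by (auto intro!: continuous_at_imp_continuous_on DERIV_isCont)
  have "continuous_on {0<..} B" "continuous_on {0<..} C"
    unfolding B_def[abs_def] C_def[abs_def] by (intro continuous_intros r cont_\<rho>''; simp)+
  then have "isCont B (norm x)" "isCont C (norm x)"
    using False by (simp_all add: continuous_on_eq_continuous_at)
  then have "isCont (\<lambda>x. B (norm x)) x" "isCont (\<lambda>x. C (norm x)) x"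
    by (intro isCont_o2[OF continuous_norm[OF continuous_ident]]; simp)+
  then show ?thesis unfolding field''_def by (intro continuous_intros)
qed

end

section \<open>Partial derivatives from Frechet derivatives\<close>

lemma pd_if_has_derivative:
  fixes f :: "real^'n::finite \<Rightarrow> 'b::real_normed_vector"
  assumes "(f has_derivative f') (at x)"
  shows "has_pd j f x" and "pd j f x = f' (axis j 1)"
proof -
  have "((\<lambda>h. x + h *\<^sub>R axis j 1) has_derivative (\<lambda>h. h *\<^sub>R axis j 1)) (at 0)"
    by (auto intro!: derivative_eq_intros)
  then have "((\<lambda>h. f (x + h *\<^sub>R axis j 1)) has_derivative (\<lambda>h. f' (h *\<^sub>R axis j 1))) (at 0)"
    by (rule has_derivative_compose) (simp add: assms)
  then have "((\<lambda>h. f (x + h *\<^sub>R axis j 1)) has_vector_derivative f' (axis j 1)) (at 0)"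
    by (simp add: has_vector_derivative_def linear_scale[OF has_derivative_linear[OF assms]])
  then show "has_pd j f x" and "pd j f x = f' (axis j 1)"
    unfolding has_pd_def pd_def by (auto intro: differentiableI_vector vector_derivative_at)
qed

text \<open>Differentiability already makes the function and its first partial derivatives
  continuous, so continuity has to be supplied for the second ones only.\<close>

lemma C2_if_has_derivative:
  fixes f :: "real^'n::finite \<Rightarrow> 'b::real_normed_vector"
  assumes f': "\<And>x. (f has_derivative f' x) (at x)"
    and f'': "\<And>e x. ((\<lambda>y. f' y e) has_derivative f'' x e) (at x)"
    and cont: "\<And>e v x. isCont (\<lambda>x. f'' x e v) x"
  shows "C2 f"
proof -
  have pd1: "pd j f = (\<lambda>x. f' x (axis j 1))" for j
    using pd_if_has_derivative(2)[OF f'] by auto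
  have pd2: "pd i (pd j f) = (\<lambda>x. f'' x (axis j 1) (axis i 1))" for i j
    using pd_if_has_derivative(2)[OF f''] by (auto simp: pd1)
  show "C2 f" unfolding C2_def
    using pd_if_has_derivative(1)[OF f'] pd_if_has_derivative(1)[OF f'']
      has_derivative_continuous[OF f'] has_derivative_continuous[OF f''] cont
    by (auto simp: pd2 continuous_on_eq_continuous_at) (simp_all add: pd1)
qed

section \<open>Complex multiples of real vectors, curl and time derivative\<close>

definition cvec :: "complex \<Rightarrow> real^3 \<Rightarrow> complex^3" where
  "cvec c v = (\<chi> k. c * of_real (v $ k))"

lemma norm_cvec: "norm (cvec c v) = norm c * norm v"
  by (simp add: norm_vec_def cvec_def norm_mult L2_set_right_distrib)

lemma bounded_linear_cvec: "bounded_linear (cvec c)"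
  by (rule linear_conv_bounded_linear[THEN iffD1], rule linearI)
    (simp_all add: cvec_def vec_eq_iff algebra_simps scaleR_conv_of_real[where 'a = complex])

lemma bounded_linear_cvec_left: "bounded_linear (\<lambda>c. cvec c v)"
  by (rule linear_conv_bounded_linear[THEN iffD1], rule linearI)
    (simp_all add: cvec_def vec_eq_iff algebra_simps)

lemma cscale_cvec: "cscale d (cvec c v) = cvec (d * c) v"
  by (simp add: cscale_def cvec_def mult.assoc)

lemma curl_0: "curl (\<lambda>_. 0) x = 0"
proof -
  have "pd j (\<lambda>_::real^3. 0::complex) = (\<lambda>_. 0)" for j
    using pd_if_has_derivative(2)[OF has_derivative_const] by auto
  then show ?thesis by (simp add: curl_def vec_eq_iff)
qed

lemma dtt_rotating:
  assumes "U x = (\<lambda>t. cvec (exp (\<i> * of_real (\<omega> * t)) * c) v)"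
  shows "dtt U x t = - \<omega>\<^sup>2 *\<^sub>R U x t"
proof -
  \<comment> \<open>Stated for every \<open>c\<close>, because the first derivative has the same
    form with \<open>c\<close> replaced by i \<omega> c; rewriting with it twice gives the factor (i
    \<omega>)^2.\<close>
  have *: "vector_derivative (\<lambda>t. cvec (exp (\<i> * of_real (\<omega> * t)) * c) v) (at t)
      = cvec (exp (\<i> * of_real (\<omega> * t)) * (\<i> * of_real \<omega> * c)) v" for c t
  proof (rule vector_derivative_at, rule bounded_linear.has_vector_derivative[OF bounded_linear_cvec_left])
    have "((\<lambda>z. exp (\<i> * (of_real \<omega> * z)) * c)
        has_field_derivative exp (\<i> * (of_real \<omega> * of_real t)) * (\<i> * of_real \<omega> * c)) (at (of_real t))"
      by (auto intro!: derivative_eq_intros simp: algebra_simps)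
    from has_vector_derivative_real_field[OF this]
    show "((\<lambda>t. exp (\<i> * of_real (\<omega> * t)) * c) has_vector_derivative
        exp (\<i> * of_real (\<omega> * t)) * (\<i> * of_real \<omega> * c)) (at t)" by simp
  qed
  show ?thesis
    unfolding dtt_def assms *
    by (simp add: cvec_def vec_eq_iff scaleR_conv_of_real[where 'a = complex] power2_eq_square algebra_simps)
qed

section \<open>From a radial profile to a continuum of breathers\<close>

context radial_profile
begin

lemma C2_cvec_field: "C2 (\<lambda>x. cvec c (field x))"
  by (rule C2_if_has_derivative[where f' = "\<lambda>x v. cvec c (field' x v)"
      and f'' = "\<lambda>x e v. cvec c (field'' x e v)"])
    (intro bounded_linear.has_derivative[OF bounded_linear_cvec] has_derivative_field has_derivative_field'
      isCont_o2[OF isCont_field''] bounded_linear.isCont[OF bounded_linear_cvec] continuous_ident)+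

text \<open>Each component of the curl is a difference of two transposed entries of the Jacobian,
  which is \<open>c\<close> times a symmetric matrix.\<close>

lemma curl_cvec_field: "curl (\<lambda>y. cvec c (field y)) x = 0"
proof -
  have "pd j (\<lambda>y. cvec c (field y) $ k) x = c * of_real (field' x (axis j 1) $ k)" for j k
    using pd_if_has_derivative(2)[OF bounded_linear.has_derivative[OF bounded_linear_vec_nth[of k]
        bounded_linear.has_derivative[OF bounded_linear_cvec[of c] has_derivative_field]], of j x]
    by (simp add: cvec_def)
  moreover have "field' x (axis j 1) $ k = field' x (axis k 1) $ j" for j k
    by (simp add: field'_def inner_axis mult.commute) (simp add: axis_def)
  ultimately show ?thesis
    by (simp add: curl_def vec_eq_iff)
qed

text \<open>Without the curl term the left side of the equation is a real scalar times
  \<open>U\<close>. Off the origin \<open>amplitude\<close> makes the scalar vanish; at the origin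
  \<open>U\<close> itself is 0.\<close>

lemma breather_continuum_cvec_field:
  assumes \<rho>_0: "\<rho> 0 = 0" and \<rho>_pos: "\<And>r. r > 0 \<Longrightarrow> \<rho> r > 0" and "T > 0" "\<delta> > 0"
    and amplitude: "\<And>x. x \<noteq> 0 \<Longrightarrow> \<sigma> * V x * \<rho> (norm x) powr (p - 1) = s x * (2 * pi / T)\<^sup>2 - q x"
    and decay: "\<And>x::real^3. \<rho> (norm x) * exp (\<delta> * norm x) \<le> K"
  shows "breather_continuum \<sigma> p T s q V \<delta>"
proof -
  define F where "F a x = cvec (cis a) (field x)" for a x
  have norm_f: "norm (field x) = \<rho> (norm x)" for x :: "real^3"
    using \<rho>_pos[of "norm x"] by (cases "x = 0") (auto simp: norm_field \<rho>_0)
  have br: "breather T (F a) = (\<lambda>x t. cvec (exp (\<i> * of_real (2 * pi / T * t)) * cis a) (field x))" for a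
    by (simp add: breather_def[abs_def] F_def cscale_cvec)
  have norm_br: "norm (breather T (F a) x t) = \<rho> (norm x)" for a x t
    by (simp only: br norm_cvec norm_mult norm_f norm_exp_i_times norm_cis mult_1_left)
  have "inj_on F {0..1}"
  proof (rule inj_onI)
    fix a b :: real assume ab: "a \<in> {0..1}" "b \<in> {0..1}" "F a = F b"
    \<comment> \<open>At a point of norm 1 the field has norm \<open>\<rho> 1 > 0\<close>, so the
      phase can be read off from the value there; \<open>cos\<close> then separates phases in [0,1],
      a part of [0,pi].\<close>
    let ?e = "axis 1 1 :: real^3"
    have "cvec (cis a - cis b) (field ?e) = 0"
      using fun_cong[OF ab(3), of ?e] bounded_linear.linear[OF bounded_linear_cvec_left, THEN linear_diff]
      by (simp add: F_def)
    then have "norm (cis a - cis b) * norm (field ?e) = 0"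
      by (metis norm_cvec norm_zero)
    then have "cis a = cis b" using \<rho>_pos[of 1] by (simp add: norm_f)
    then have "cos a = cos b" by (simp add: complex_eq_iff)
    then show "a = b" using ab pi_gt3 cos_inj_pi[of a b] by simp
  qed
  moreover have "good_breather \<sigma> p T s q V \<delta> (F a)" for a
    unfolding good_breather_def
  proof (intro conjI allI)
    show "C2 (F a)" unfolding F_def[abs_def] by (rule C2_cvec_field)
    show "\<exists>K. \<forall>x. norm (F a x) * exp (\<delta> * norm x) \<le> K"
      using decay by (auto simp: F_def norm_cvec norm_f)
    show "breather T (F a) x (t + T) = breather T (F a) x t" for x t
    proof -
      have "\<i> * of_real (2 * pi / T * (t + T)) = \<i> * of_real (2 * pi / T * t) + of_real (2 * pi) * \<i>"
        using \<open>T > 0\<close> by (simp add: field_simps)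
      then have "exp (\<i> * of_real (2 * pi / T * (t + T))) = exp (\<i> * of_real (2 * pi / T * t))"
        by (simp only: exp_add) simp
      then show ?thesis by (simp only: br)
    qed
    show "solves_eq \<sigma> p s q V (breather T (F a))" unfolding solves_eq_def
    proof (intro allI)
      fix x t
      let ?U = "breather T (F a)"
      have "curl (\<lambda>y. ?U y t) = (\<lambda>_. 0)"
        unfolding br by (intro ext curl_cvec_field)
      then have "s x *\<^sub>R dtt ?U x t + curl (curl (\<lambda>y. ?U y t)) x + q x *\<^sub>R ?U x t
            + (\<sigma> * V x * norm (?U x t) powr (p - 1)) *\<^sub>R ?U x t
          = (q x - s x * (2 * pi / T)\<^sup>2 + \<sigma> * V x * \<rho> (norm x) powr (p - 1)) *\<^sub>R ?U x t"
        unfolding norm_br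
        by (subst dtt_rotating[where U = ?U and \<omega> = "2 * pi / T" and c = "cis a" and v = "field x"])
          (simp add: br, simp add: curl_0 algebra_simps)
      also have "\<dots> = 0"
        using amplitude[of x] norm_br[of a x t] by (cases "x = 0") (auto simp: \<rho>_0)
      finally show "s x *\<^sub>R dtt ?U x t + curl (curl (\<lambda>y. ?U y t)) x + q x *\<^sub>R ?U x t
            + (\<sigma> * V x * norm (?U x t) powr (p - 1)) *\<^sub>R ?U x t = 0" .
    qed
  qed
  moreover have "\<exists>d>0. \<forall>a\<in>{0..1}. \<bar>a - a0\<bar> < d \<longrightarrow> (\<forall>x. norm (F a x - F a0 x) \<le> \<epsilon>)"
    if "\<epsilon> > 0" for a0 \<epsilon> :: real
  proof -
    \<comment> \<open>The exponential weight is at least 1, so the decay constant also bounds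
      \<open>\<rho>\<close> uniformly. Hence continuity of the phase factor yields uniform
      convergence of the profiles.\<close>
    have \<rho>_le: "0 \<le> \<rho> (norm x)" "\<rho> (norm x) \<le> K" for x :: "real^3"
    proof -
      show *: "0 \<le> \<rho> (norm x)" using norm_f[of x] by (metis norm_ge_zero)
      have "\<rho> (norm x) * 1 \<le> \<rho> (norm x) * exp (\<delta> * norm x)"
        using * \<open>\<delta> > 0\<close> by (intro mult_left_mono) auto
      then show "\<rho> (norm x) \<le> K" using decay[of x] by simp
    qed
    then have K: "K \<ge> 0" by (meson order_trans)
    have "isCont (\<lambda>a. exp (\<i> * of_real a)) a0" by (intro continuous_intros)
    then have "isCont cis a0" by (simp add: cis_conv_exp[abs_def])
    \<comment> \<open>Only \<open>K \<ge> 0\<close> has been established; adding 1 makes the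
      division safe.\<close>
    moreover have "\<epsilon> / (K + 1) > 0" using that K by simp
    ultimately obtain d where d: "d > 0" "\<And>a. dist a a0 < d \<Longrightarrow> dist (cis a) (cis a0) < \<epsilon> / (K + 1)"
      unfolding continuous_at_eps_delta by meson
    show ?thesis
    proof (intro exI[of _ d] conjI ballI impI allI d(1))
      fix a x assume "\<bar>a - a0\<bar> < d"
      then have *: "norm (cis a - cis a0) < \<epsilon> / (K + 1)" using d(2)[of a] by (simp add: dist_norm)
      have "norm (F a x - F a0 x) = norm (cis a - cis a0) * \<rho> (norm x)"
        using linear_diff[OF bounded_linear.linear[OF bounded_linear_cvec_left],
          of "cis a" "cis a0" "field x"]
        by (simp add: F_def flip: norm_cvec norm_f)
      also have "\<dots> \<le> \<epsilon> / (K + 1) * (K + 1)"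
        using * \<rho>_le[of x] K that by (intro mult_mono) auto
      finally show "norm (F a x - F a0 x) \<le> \<epsilon>" using K by simp
    qed
  qed
  ultimately show ?thesis unfolding breather_continuum_def by blast
qed

end


section \<open>Explicit first and second derivatives of functions of one variable\<close>

definition C2_derivs :: "real set \<Rightarrow> (real \<Rightarrow> real) \<Rightarrow> (real \<Rightarrow> real) \<Rightarrow> (real \<Rightarrow> real) \<Rightarrow> bool" where
  "C2_derivs S f f' f'' \<longleftrightarrow> (\<forall>t\<in>S. (f has_real_derivative f' t) (at t))
     \<and> (\<forall>t\<in>S. (f' has_real_derivative f'' t) (at t)) \<and> continuous_on S f''"

lemma C2_derivsD:
  assumes "C2_derivs S f f' f''"
  shows "\<And>t. t \<in> S \<Longrightarrow> (f has_real_derivative f' t) (at t)"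
    and "\<And>t. t \<in> S \<Longrightarrow> (f' has_real_derivative f'' t) (at t)"
    and "continuous_on S f" "continuous_on S f'" "continuous_on S f''"
  using assms unfolding C2_derivs_def
  by (auto intro!: continuous_at_imp_continuous_on DERIV_isCont)

lemma C2_derivs_subset: "C2_derivs S f f' f'' \<Longrightarrow> R \<subseteq> S \<Longrightarrow> C2_derivs R f f' f''"
  unfolding C2_derivs_def by (auto intro: continuous_on_subset)

lemma C2_derivs_cong:
  assumes "open S" "\<And>t. t \<in> S \<Longrightarrow> f t = g t" "C2_derivs S f f' f''"
  shows "C2_derivs S g f' f''"
  using assms unfolding C2_derivs_def by (auto intro: has_field_derivative_transform_within_open)

lemma C2_derivs_const: "C2_derivs S (\<lambda>_. c) (\<lambda>_. 0) (\<lambda>_. 0)"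
  by (simp add: C2_derivs_def)

lemma C2_derivs_add:
  assumes "C2_derivs S f f' f''" "C2_derivs S g g' g''"
  shows "C2_derivs S (\<lambda>t. f t + g t) (\<lambda>t. f' t + g' t) (\<lambda>t. f'' t + g'' t)"
  using assms unfolding C2_derivs_def by (auto intro!: DERIV_add continuous_on_add)

lemma C2_derivs_mult:
  assumes "C2_derivs S f f' f''" "C2_derivs S g g' g''"
  shows "C2_derivs S (\<lambda>t. f t * g t) (\<lambda>t. f' t * g t + f t * g' t)
    (\<lambda>t. f'' t * g t + 2 * (f' t * g' t) + f t * g'' t)"
  unfolding C2_derivs_def
  using C2_derivsD[OF assms(1)] C2_derivsD[OF assms(2)]
  by (auto intro!: continuous_intros derivative_eq_intros simp: algebra_simps)

lemma C2_derivs_powr: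
  assumes "C2_derivs S f f' f''" and "\<forall>t\<in>S. f t > 0"
  shows "C2_derivs S (\<lambda>t. f t powr c) (\<lambda>t. c * f t powr (c - 1) * f' t)
    (\<lambda>t. c * ((c - 1) * f t powr (c - 2) * (f' t)\<^sup>2 + f t powr (c - 1) * f'' t))"
proof -
  note f = C2_derivsD[OF assms(1)]
  have pos: "f t > 0" if "t \<in> S" for t using assms(2) that by simp
  \<comment> \<open>The exponent is generalised because the second derivative needs the rule for
    \<open>c - 1\<close>.\<close>
  have powr: "((\<lambda>t. f t powr c) has_real_derivative c * f t powr (c - 1) * f' t) (at t)" if "t \<in> S" for c t
    using DERIV_chain2[OF has_real_derivative_powr[OF pos[OF that], of c] f(1)[OF that]] .
  show ?thesis unfolding C2_derivs_def
  proof (intro conjI ballI)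
    fix t assume t: "t \<in> S"
    show "((\<lambda>t. f t powr c) has_real_derivative c * f t powr (c - 1) * f' t) (at t)"
      by (rule powr[OF t])
    show "((\<lambda>t. c * f t powr (c - 1) * f' t) has_real_derivative
        c * ((c - 1) * f t powr (c - 2) * (f' t)\<^sup>2 + f t powr (c - 1) * f'' t)) (at t)"
      by (rule derivative_eq_intros powr[OF t] f(2)[OF t] refl)+
        (simp add: algebra_simps power2_eq_square)
  qed (intro continuous_intros f; use pos in force)
qed

section \<open>Restriction of functions on space to a coordinate axis\<close>

lemma has_vector_derivative_shift:
  "((\<lambda>h. f (t + h)) has_vector_derivative D) (at 0) \<longleftrightarrow> (f has_vector_derivative D) (at t)"
  by (simp add: has_vector_derivative_def has_derivative_at)

text \<open>Both sides choose a derivative by the same predicate, up to moving the base point from 0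
  to \<open>t\<close>; the equation therefore holds without any differentiability.\<close>

lemma pd_line:
  "pd j f (t *\<^sub>R axis j 1) = vector_derivative (\<lambda>t. f (t *\<^sub>R axis j 1)) (at t)"
  using has_vector_derivative_shift[of "\<lambda>t. f (t *\<^sub>R axis j 1)" t]
  by (simp add: pd_def vector_derivative_def scaleR_add_left)

lemma C2_derivs_line:
  fixes f :: "real^'n::finite \<Rightarrow> real"
  assumes "C2 f"
  shows "C2_derivs UNIV (\<lambda>t. f (t *\<^sub>R axis j 1)) (\<lambda>t. pd j f (t *\<^sub>R axis j 1))
    (\<lambda>t. pd j (pd j f) (t *\<^sub>R axis j 1))"
proof -
  have line: "((\<lambda>t. g (t *\<^sub>R axis j 1)) has_real_derivative pd j g (t *\<^sub>R axis j 1)) (at t)"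
    if "has_pd j g (t *\<^sub>R axis j 1)" for g :: "real^'n \<Rightarrow> real" and t
    using that has_vector_derivative_shift[of "\<lambda>t. g (t *\<^sub>R axis j 1)" t]
    unfolding has_pd_def pd_def vector_derivative_works has_real_derivative_iff_has_vector_derivative
    by (simp add: scaleR_add_left)
  have "continuous_on UNIV (pd j (pd j f))" using assms by (simp add: C2_def)
  then have "continuous_on UNIV (\<lambda>t. pd j (pd j f) (t *\<^sub>R axis j 1))"
    by (rule continuous_on_compose2) (auto intro!: continuous_intros)
  then show ?thesis using assms unfolding C2_derivs_def by (auto intro!: line simp: C2_def)
qed

text \<open>On the open half-axis the pure partial derivatives in direction \<open>j\<close> are the
  ordinary derivatives \<open>w'\<close> and \<open>w''\<close>, so limits at the origin of space
  become one-sided limits.\<close>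

lemma C2_tends_zero_line:
  fixes w :: "real^'n::finite \<Rightarrow> real"
  assumes w: "C2_tends_zero w" and d: "C2_derivs {0<..} (\<lambda>t. w (t *\<^sub>R axis j 1)) w' w''"
  shows "((\<lambda>t. w (t *\<^sub>R axis j 1)) \<longlongrightarrow> 0) (at_right 0)" "(w' \<longlongrightarrow> 0) (at_right 0)"
    "(w'' \<longlongrightarrow> 0) (at_right 0)"
proof -
  have "((\<lambda>t. t *\<^sub>R axis j 1 :: real^'n) \<longlongrightarrow> 0) (at_right 0)"
    by (auto intro!: tendsto_eq_intros)
  then have lim: "filterlim (\<lambda>t. t *\<^sub>R axis j 1 :: real^'n) (at 0) (at_right 0)"
    by (auto simp: filterlim_at eventually_at_filter)
  have vd: "vector_derivative g (at t) = d" if "(g has_real_derivative d) (at t)" for g :: "real \<Rightarrow> real" and d t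
    using that by (simp add: has_real_derivative_iff_has_vector_derivative vector_derivative_at)
  have w': "pd j w (t *\<^sub>R axis j 1) = w' t" if "t > 0" for t
    using that C2_derivsD(1)[OF d] by (simp add: pd_line vd)
  have w'': "pd j (pd j w) (t *\<^sub>R axis j 1) = w'' t" if "t > 0" for t
    unfolding pd_line[of j "pd j w"]
  \<comment> \<open>The first partial derivative is identified with \<open>w'\<close> for positive
    arguments only, hence the open half-line.\<close>
  proof (rule vd, rule has_field_derivative_transform_within_open[where S = "{0<..}"])
    show "(w' has_real_derivative w'' t) (at t)" using that C2_derivsD(2)[OF d] by simp
  qed (use that w' in auto)
  have l: "(w \<longlongrightarrow> 0) (at 0)" "(pd j w \<longlongrightarrow> 0) (at 0)" "(pd j (pd j w) \<longlongrightarrow> 0) (at 0)"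
    using w by (simp_all add: C2_tends_zero_def)
  show "((\<lambda>t. w (t *\<^sub>R axis j 1)) \<longlongrightarrow> 0) (at_right 0)"
    by (rule filterlim_compose[OF l(1) lim])
  show "(w' \<longlongrightarrow> 0) (at_right 0)"
    by (rule Lim_transform_eventually[OF filterlim_compose[OF l(2) lim]])
      (auto simp: eventually_at_filter w')
  show "(w'' \<longlongrightarrow> 0) (at_right 0)"
    by (rule Lim_transform_eventually[OF filterlim_compose[OF l(3) lim]])
      (auto simp: eventually_at_filter w'')
qed

section \<open>The amplitude of the breather\<close>

lemma radial_profile_mult:
  assumes w: "C2_derivs {0<..} w w' w''" and m: "C2_derivs UNIV m m' m''"
    and lim: "(w \<longlongrightarrow> 0) (at_right 0)" "(w' \<longlongrightarrow> 0) (at_right 0)" "(w'' \<longlongrightarrow> 0) (at_right 0)"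
  shows "radial_profile (\<lambda>t. w t * m t) (\<lambda>t. w' t * m t + w t * m' t)
    (\<lambda>t. w'' t * m t + 2 * (w' t * m' t) + w t * m'' t)"
proof -
  \<comment> \<open>Every term of the product rule has a factor \<open>w\<close>, \<open>w'\<close>
    or \<open>w''\<close> tending to 0, while the factor from \<open>m\<close> has a finite limit by
    continuity.\<close>
  have "(g \<longlongrightarrow> g 0) (at_right 0)" if "continuous_on UNIV g" for g :: "real \<Rightarrow> real"
    using that by (simp add: continuous_on_def Lim_at_imp_Lim_at_within)
  note ml = this[OF C2_derivsD(3)[OF m]] this[OF C2_derivsD(4)[OF m]] this[OF C2_derivsD(5)[OF m]]
  note prod = C2_derivsD[OF C2_derivs_mult[OF w C2_derivs_subset[OF m subset_UNIV]]]
  show ?thesis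
  proof
    show "((\<lambda>t. w t * m t) \<longlongrightarrow> 0) (at_right 0)"
      using tendsto_mult[OF lim(1) ml(1)] by simp
    show "((\<lambda>t. w' t * m t + w t * m' t) \<longlongrightarrow> 0) (at_right 0)"
      using tendsto_add[OF tendsto_mult[OF lim(2) ml(1)] tendsto_mult[OF lim(1) ml(2)]] by simp
    show "((\<lambda>t. w'' t * m t + 2 * (w' t * m' t) + w t * m'' t) \<longlongrightarrow> 0) (at_right 0)"
      using tendsto_add[OF tendsto_add[OF tendsto_mult[OF lim(3) ml(1)]
        tendsto_mult[OF tendsto_const[of 2] tendsto_mult[OF lim(2) ml(2)]]] tendsto_mult[OF lim(1) ml(3)]]
      by simp
  qed (use prod in auto)
qed

text \<open>Both cases at once: \<open>\<tau>\<close> is the sign of 2 pi - T sqrt(q/s) off the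
  origin and also the sign of the nonlinearity.\<close>

lemma breather_continuum_if_sign:
  fixes p \<delta> \<tau> :: real and s q V :: "real^3 \<Rightarrow> real"
  defines "T \<equiv> 2 * pi * sqrt (s 0 / q 0)"
  assumes p: "p > 1"
    and pos: "\<forall>x. s x > 0 \<and> q x > 0 \<and> V x > 0"
    and radial: "radial s" "radial q" "radial V"
    and C2: "C2 s" "C2 q" "C2 V"
    and \<tau>: "\<tau> = 1 \<or> \<tau> = -1"
    and sign: "\<And>x. x \<noteq> 0 \<Longrightarrow> \<tau> * (2 * pi - T * sqrt (q x / s x)) > 0"
    and H2: "C2_tends_zero (\<lambda>x. \<bar>2 * pi - T * sqrt (q x / s x)\<bar> powr (1 / (p - 1)))"
    and \<delta>: "\<delta> > 0"
    and H3: "\<exists>C. \<forall>x. \<bar>2 * pi - T * sqrt (q x / s x)\<bar> * exp (\<delta> * (p - 1) * norm x) \<le> C"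
    and H4: "\<exists>C. \<forall>x. q x / V x \<le> C"
  shows "breather_continuum \<tau> p T s q V \<delta>"
proof -
  have s: "s x > 0" and q: "q x > 0" and V: "V x > 0" for x using pos by auto
  have T: "T > 0" using s[of 0] q[of 0] by (simp add: T_def)
  \<comment> \<open>Since q = s k^2 / T^2, the term s (2 pi / T)^2 - q equals s (2 pi - k)(2 pi + k)
    / T^2. Dividing by \<open>V\<close> splits the required power of the amplitude into
    \<open>P\<close>, which degenerates at 0, and the positive \<open>M\<close>; \<open>w\<close>
    and \<open>m\<close> are their roots of order p - 1.\<close>
  define k where "k x = T * sqrt (q x / s x)" for x
  define P where "P x = \<bar>2 * pi - k x\<bar>" for x
  define M where "M x = s x * (2 * pi + k x) / (T\<^sup>2 * V x)" for x
  define w where "w x = P x powr (1 / (p - 1))" for x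
  define m where "m x = M x powr (1 / (p - 1))" for x
  define e where "e = (axis 1 1 :: real^3)"
  define \<rho> where "\<rho> t = w (t *\<^sub>R e) * m (t *\<^sub>R e)" for t
  have k_pos: "k x > 0" for x using s[of x] q[of x] T by (simp add: k_def)
  have M_pos: "M x > 0" for x
    unfolding M_def using s[of x] V[of x] T k_pos[of x] pi_gt_zero
    by (intro divide_pos_pos mult_pos_pos add_pos_pos) auto
  have P_eq: "P x = \<tau> * (2 * pi - k x)" "P x > 0" if "x \<noteq> 0" for x
    using \<tau> sign[OF that] by (auto simp: P_def k_def)
  \<comment> \<open>This is what the value of \<open>T\<close> achieves: \<open>P\<close> vanishes
    at the origin, and a power of 0 is 0.\<close>
  have "k 0 = 2 * pi"
    using s[of 0] q[of 0] by (simp add: k_def T_def real_sqrt_mult[symmetric])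
  then have \<rho>_0: "\<rho> 0 = 0" by (simp add: \<rho>_def w_def P_def)
  have \<rho>_norm: "\<rho> (norm x) = w x * m x" for x
  proof -
    have "norm (norm x *\<^sub>R e) = norm x" by (simp add: e_def)
    then have "s (norm x *\<^sub>R e) = s x" "q (norm x *\<^sub>R e) = q x" "V (norm x *\<^sub>R e) = V x"
      using radial unfolding radial_def by metis+
    then show ?thesis by (simp add: \<rho>_def w_def m_def P_def M_def k_def)
  qed
  have wm_powr: "(w x * m x) powr (p - 1) = P x * M x" for x
    using M_pos[of x] p by (simp add: w_def m_def powr_mult powr_powr P_def)

  obtain s' s'' where s_line: "C2_derivs UNIV (\<lambda>t. s (t *\<^sub>R e)) s' s''"
    using C2_derivs_line[OF C2(1)] unfolding e_def by blast
  obtain q' q'' where q_line: "C2_derivs UNIV (\<lambda>t. q (t *\<^sub>R e)) q' q''"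
    using C2_derivs_line[OF C2(2)] unfolding e_def by blast
  obtain V' V'' where V_line: "C2_derivs UNIV (\<lambda>t. V (t *\<^sub>R e)) V' V''"
    using C2_derivs_line[OF C2(3)] unfolding e_def by blast
  obtain k' k'' where k_line: "C2_derivs UNIV (\<lambda>t. k (t *\<^sub>R e)) k' k''"
  proof -
    have eq: "(\<lambda>t. k (t *\<^sub>R e)) = (\<lambda>t. T * (q (t *\<^sub>R e) * s (t *\<^sub>R e) powr (-1)) powr (1/2))"
      using s q by (auto simp: k_def powr_minus_divide powr_half_sqrt less_imp_le)
    have pos: "\<forall>t\<in>UNIV. s (t *\<^sub>R e) > 0" "\<forall>t\<in>UNIV. q (t *\<^sub>R e) * s (t *\<^sub>R e) powr (-1) > 0"
      using s q by (simp_all add: abs_of_pos)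
    show ?thesis
      \<comment> \<open>The derivatives are never written out: \<open>that\<close> leaves them
        schematic, and unification with the product and power rules produces them.\<close>
      by (rule that, unfold eq, rule C2_derivs_mult[OF C2_derivs_const
          C2_derivs_powr[OF C2_derivs_mult[OF q_line C2_derivs_powr[OF s_line pos(1)]] pos(2)]])
  qed
  obtain m' m'' where m_line: "C2_derivs UNIV (\<lambda>t. m (t *\<^sub>R e)) m' m''"
  proof -
    have eq: "M (t *\<^sub>R e) = s (t *\<^sub>R e) * (2 * pi + k (t *\<^sub>R e)) * (T\<^sup>2 * V (t *\<^sub>R e)) powr (-1)" for t
      using T V[of "t *\<^sub>R e"] by (simp add: M_def powr_minus_divide)
    have pos: "\<forall>t\<in>UNIV. T\<^sup>2 * V (t *\<^sub>R e) > 0" "\<forall>t\<in>UNIV. M (t *\<^sub>R e) > 0"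
      using T V M_pos by simp_all
    show ?thesis
      by (rule that, unfold m_def eq, rule C2_derivs_powr[OF C2_derivs_mult[OF C2_derivs_mult[OF s_line
          C2_derivs_add[OF C2_derivs_const k_line]] C2_derivs_powr[OF C2_derivs_mult[OF C2_derivs_const V_line] pos(1)]]
          pos(2)[unfolded eq]])
  qed
  obtain w' w'' where w_line: "C2_derivs {0<..} (\<lambda>t. w (t *\<^sub>R e)) w' w''"
  proof -
    \<comment> \<open>On the open half-line the sign \<open>\<tau>\<close> resolves the absolute
      value in \<open>P\<close>, so \<open>w\<close> is a power of a positive C^2 function.\<close>
    have pos: "\<forall>t\<in>{0<..}. \<tau> * (2 * pi + (-1) * k (t *\<^sub>R e)) > 0"
      using P_eq by (simp add: e_def)
    have eq: "(\<tau> * (2 * pi + (-1) * k (t *\<^sub>R e))) powr (1 / (p - 1)) = w (t *\<^sub>R e)" if "t \<in> {0<..}" for t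
      using P_eq(1)[of "t *\<^sub>R e"] that by (simp add: w_def e_def)
    show ?thesis
      by (rule that, rule C2_derivs_cong[OF open_greaterThan eq], assumption,
          rule C2_derivs_powr[OF C2_derivs_mult[OF C2_derivs_const C2_derivs_add[OF C2_derivs_const
            C2_derivs_mult[OF C2_derivs_const C2_derivs_subset[OF k_line subset_UNIV]]]] pos])
  qed
  have "C2_tends_zero w" using H2 by (simp add: w_def[abs_def] P_def k_def)
  note lim = C2_tends_zero_line[OF this w_line[unfolded e_def], folded e_def]
  interpret radial_profile \<rho> "\<lambda>t. w' t * m (t *\<^sub>R e) + w (t *\<^sub>R e) * m' t"
    "\<lambda>t. w'' t * m (t *\<^sub>R e) + 2 * (w' t * m' t) + w (t *\<^sub>R e) * m'' t"
    unfolding \<rho>_def[abs_def] by (rule radial_profile_mult[OF w_line m_line lim])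

  obtain C3 where C3: "P x * exp (\<delta> * (p - 1) * norm x) \<le> C3" for x
    using H3 by (auto simp: P_def k_def)
  obtain C4 where C4: "q x / V x \<le> C4" for x using H4 by auto
  have "P x * 1 \<le> P x * exp (\<delta> * (p - 1) * norm x)" for x
    using \<delta> p by (intro mult_left_mono) (auto simp: P_def)
  from order_trans[OF this C3] have P_le: "P x \<le> C3" for x by simp
  \<comment> \<open>(H4) controls q/V, but \<open>M\<close> contains s/V. Beyond radius
    \<open>R\<close> the bound exp y >= y turns (H3) into P < pi, so k > pi and s/V = (q/V) T^2 /
    k^2 is controlled; the remaining ball is compact.\<close>
  define R where "R = C3 / (pi * (\<delta> * (p - 1)))"
  have far: "s x / V x \<le> C4 * T\<^sup>2 / pi\<^sup>2" if "norm x > R" for x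
  proof -
    have "P x * (\<delta> * (p - 1) * norm x) \<le> P x * exp (\<delta> * (p - 1) * norm x)"
      by (intro mult_left_mono order_trans[OF _ exp_ge_add_one_self]) (auto simp: P_def)
    also have "\<dots> \<le> C3" by (rule C3)
    also have "\<dots> < pi * (\<delta> * (p - 1) * norm x)"
      using that \<delta> p by (simp add: R_def field_simps)
    finally have "P x < pi"
      using \<delta> p by (simp add: mult_less_cancel_right)
    then have "pi < k x" by (simp add: P_def)
    then have "pi\<^sup>2 < (k x)\<^sup>2" by (intro power_strict_mono) auto
    also have "(k x)\<^sup>2 = T\<^sup>2 * (q x / s x)" using s[of x] q[of x] by (simp add: k_def power_mult_distrib)
    finally have "s x / V x \<le> q x / V x * T\<^sup>2 / pi\<^sup>2"
      using s[of x] V[of x] by (simp add: field_simps)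
    also have "\<dots> \<le> C4 * T\<^sup>2 / pi\<^sup>2"
      by (intro divide_right_mono mult_right_mono C4) auto
    finally show ?thesis .
  qed
  have "continuous_on (cball 0 R) (\<lambda>x. s x / V x)"
    using C2 V by (intro continuous_on_divide) (auto simp: C2_def less_imp_neq[symmetric] intro: continuous_on_subset)
  then have "bounded ((\<lambda>x. s x / V x) ` cball 0 R)"
    by (intro compact_imp_bounded compact_continuous_image) auto
  then obtain C5 where "\<forall>y \<in> (\<lambda>x. s x / V x) ` cball 0 R. norm y \<le> C5"
    unfolding bounded_iff by blast
  then have C5: "s x / V x \<le> C5" if "norm x \<le> R" for x
    using that abs_le_D1[of "s x / V x" C5] by (simp only: ball_simps mem_cball_0 real_norm_def)
  define C6 where "C6 = max (C4 * T\<^sup>2 / pi\<^sup>2) C5"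
  have C6: "s x / V x \<le> C6" for x
    using far[of x] C5[of x] by (cases "norm x \<le> R") (auto simp: C6_def)
  \<comment> \<open>k <= 2 pi + P <= 2 pi + C3, so the factor 2 pi + k is at most 4 pi + C3.\<close>
  have M_le: "M x \<le> C6 * (4 * pi + C3) / T\<^sup>2" for x
  proof -
    have "M x = s x / V x * (2 * pi + k x) / T\<^sup>2" by (simp add: M_def)
    also have "\<dots> \<le> C6 * (4 * pi + C3) / T\<^sup>2"
      using C6[of x] P_le[of x] k_pos[of x] s[of x] V[of x]
      by (intro divide_right_mono mult_mono) (auto simp: P_def intro: order_trans[rotated])
    finally show ?thesis .
  qed
  \<comment> \<open>The power p - 1 of \<rho> exp(\<delta>|x|) is P exp(\<delta>(p-1)|x|) times
    \<open>M\<close>, bounded by \<open>C3\<close> and \<open>M_le\<close>; \<open>K\<close> is the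
    root of that product.\<close>
  define K where "K = (C3 * (C6 * (4 * pi + C3) / T\<^sup>2)) powr (1 / (p - 1))"
  show ?thesis
  proof (rule breather_continuum_cvec_field[OF \<rho>_0 _ T \<delta>])
    show "\<rho> r > 0" if "r > 0" for r
      using P_eq(2)[of "r *\<^sub>R e"] M_pos[of "r *\<^sub>R e"] that by (simp add: \<rho>_def w_def m_def e_def)
    show "\<rho> (norm x) * exp (\<delta> * norm x) \<le> K" for x :: "real^3"
    proof -
      have "exp (\<delta> * norm x) = exp (\<delta> * (p - 1) * norm x) powr (1 / (p - 1))"
        using p by (simp add: powr_def)
      then have "\<rho> (norm x) * exp (\<delta> * norm x)
          = (P x * exp (\<delta> * (p - 1) * norm x) * M x) powr (1 / (p - 1))"
        using M_pos[of x] by (simp add: \<rho>_norm w_def m_def powr_mult P_def)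
      also have "\<dots> \<le> K"
        unfolding K_def using C3[of x] M_le[of x] M_pos[of x] p
        by (intro powr_mono2 mult_mono) (auto simp: P_def less_imp_le intro: order_trans[rotated])
      finally show ?thesis .
    qed
    show "\<tau> * V x * \<rho> (norm x) powr (p - 1) = s x * (2 * pi / T)\<^sup>2 - q x" if "x \<noteq> 0" for x
    proof -
      \<comment> \<open>One \<open>\<tau>\<close> is the sign in the equation, the other comes from
        removing the absolute value in \<open>P\<close>; their product is 1.\<close>
      have "\<tau> * V x * \<rho> (norm x) powr (p - 1) = \<tau>\<^sup>2 * (s x * ((2 * pi)\<^sup>2 - (k x)\<^sup>2) / T\<^sup>2)"
        unfolding \<rho>_norm wm_powr P_eq(1)[OF that] using V[of x] T
        by (simp add: M_def field_simps power2_eq_square)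
      also have "\<tau>\<^sup>2 = 1" using \<tau> by auto
      also have "(k x)\<^sup>2 = T\<^sup>2 * (q x / s x)" using s[of x] q[of x] by (simp add: k_def power_mult_distrib)
      also have "1 * (s x * ((2 * pi)\<^sup>2 - T\<^sup>2 * (q x / s x)) / T\<^sup>2) = s x * (2 * pi / T)\<^sup>2 - q x"
        using s[of x] T by (simp add: field_simps)
      finally show ?thesis .
    qed
  qed
qed

theorem theorem1p3:
  fixes p \<delta> :: real and s q V :: "real^3 \<Rightarrow> real"
  defines "T \<equiv> 2 * pi * sqrt (s 0 / q 0)"
  assumes p: "p > 1"
    and pos: "\<forall>x. s x > 0 \<and> q x > 0 \<and> V x > 0"
    and radial: "radial s" "radial q" "radial V"
    and C2: "C2 s" "C2 q" "C2 V"
    and H1: "(\<forall>x. x \<noteq> 0 \<longrightarrow> T * sqrt (q x / s x) < 2 * pi)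
           \<or> (\<forall>x. x \<noteq> 0 \<longrightarrow> T * sqrt (q x / s x) > 2 * pi)"
    and H2: "C2_tends_zero (\<lambda>x. \<bar>2 * pi - T * sqrt (q x / s x)\<bar> powr (1 / (p - 1)))"
    and \<delta>: "\<delta> > 0"
    and H3: "\<exists>C. \<forall>x. \<bar>2 * pi - T * sqrt (q x / s x)\<bar> * exp (\<delta> * (p - 1) * norm x) \<le> C"
    and H4: "\<exists>C. \<forall>x. q x / V x \<le> C"
  shows "((\<forall>x. x \<noteq> 0 \<longrightarrow> T * sqrt (q x / s x) < 2 * pi) \<longrightarrow> breather_continuum 1 p T s q V \<delta>)
       \<and> ((\<forall>x. x \<noteq> 0 \<longrightarrow> T * sqrt (q x / s x) > 2 * pi) \<longrightarrow> breather_continuum (-1) p T s q V \<delta>)"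
proof -
  \<comment> \<open>The sign and the two hypotheses about it stay open, so that one fact serves both
    cases.\<close>
  note main = breather_continuum_if_sign[of p s q V _ \<delta>, folded T_def, OF p pos radial C2 _ _ H2 \<delta> H3 H4]
  show ?thesis
    by (intro conjI impI main) auto
qed

end
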